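(* Let $p$ be a prime number and let $0\leq k\leq m$ be integers. Then \[ s_p(\Delta^m_{(k)})\geq m+1-\left\lceil \log_p\left(1+\binom{m}{0}+(p-1)\binom{m}{1}+\cdots+(p-1)^k\binom{m}{k}\right)\right\rceil. \]
   Context: For a prime $p$ and an integer $n\ge 0$, the universal simplicial complex $X(\mathbb{F}_p^n)$ is the abstract simplicial complex whose vertices are the nonzero vectors of $\mathbb{F}_p^n$ and whose simplices are the sets of vectors that are linearly independent over $\mathbb{F}_p$. A simplicial map is nondegenerate if it is injective on the vertex set of every simplex (equivalently, it maps every $j$-simplex onto a $j$-simplex). For a finite simplicial complex $\mathcal{K}$ with $N$ vertices, the mod $p$ Buchstaber invariant of $\mathcal{K}$ is the integer $s_p(\mathcal{K})=N-r$, where $r$ is the least integer such that there is a nondegenerate simplicial map $\mathcal{K}\to X(\mathbb{F}_p^r)$. $\Delta^m$ is the $m$-simplex on the vertex set $\{1,\ldots,m+1\}$, and $\Delta^m_{(k)}$ is its $k$-skeleton, i.e. the simplices are the subsets of $\{1,\ldots,m+1\}$ with at most $k+1$ elements. *)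

theory Defs
  imports "HOL-Number_Theory.Residues" "Jordan_Normal_Form.Missing_VectorSpace"
begin

text \<open>An abstract simplicial complex is given by its set of simplices (the empty simplex included);
  its vertices are the elements of its simplices.\<close>

definition simplicial_complex :: "'a set set \<Rightarrow> bool" where
  "simplicial_complex K \<longleftrightarrow> {} \<in> K \<and> (\<forall>S\<in>K. finite S \<and> (\<forall>T\<subseteq>S. T \<in> K))"

definition vertices :: "'a set set \<Rightarrow> 'a set" where
  "vertices K = \<Union>K"

definition simplicial_map :: "'a set set \<Rightarrow> 'b set set \<Rightarrow> ('a \<Rightarrow> 'b) \<Rightarrow> bool" where
  "simplicial_map K L f \<longleftrightarrow> f ` vertices K \<subseteq> vertices L \<and> (\<forall>S\<in>K. f ` S \<in> L)"

definition nondegenerate_simplicial_map :: "'a set set \<Rightarrow> 'b set set \<Rightarrow> ('a \<Rightarrow> 'b) \<Rightarrow> bool" where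
  "nondegenerate_simplicial_map K L f \<longleftrightarrow> simplicial_map K L f \<and> (\<forall>S\<in>K. inj_on f S)"

text \<open>The coordinate space of dimension \<open>n\<close> over the field of \<open>p\<close> elements, coordinates being
  indexed by \<open>0, \<dots>, n - 1\<close>.\<close>

definition Fp_space :: "nat \<Rightarrow> nat \<Rightarrow> (int, nat \<Rightarrow> int) module" where
  "Fp_space p n = ring.func_space (residue_ring (int p)) {..<n}"

text \<open>\<^const>\<open>module.lin_dep\<close> does not itself require its argument to lie in the carrier. The
  nonzero vectors are the vertices because the zero vector lies in no independent set; see
  \<open>vertices_universal_complex\<close> below.\<close>

definition universal_complex :: "nat \<Rightarrow> nat \<Rightarrow> (nat \<Rightarrow> int) set set" where
  "universal_complex p n =
     {S. S \<subseteq> carrier (Fp_space p n) \<and> \<not> module.lin_dep (residue_ring (int p)) (Fp_space p n) S}"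

definition buchstaber_mod :: "nat \<Rightarrow> 'a set set \<Rightarrow> int" where
  "buchstaber_mod p K = int (card (vertices K)) -
     int (LEAST r. \<exists>f. nondegenerate_simplicial_map K (universal_complex p r) f)"

definition simplex_skeleton :: "nat \<Rightarrow> nat \<Rightarrow> nat set set" where
  "simplex_skeleton m k = {S. S \<subseteq> {1..m + 1} \<and> card S \<le> k + 1}"

lemma simplicial_complex_simplex_skeleton: "simplicial_complex (simplex_skeleton m k)"
proof -
  have "finite S \<and> (\<forall>T\<subseteq>S. T \<in> simplex_skeleton m k)" if "S \<in> simplex_skeleton m k" for S
  proof -
    from that have S: "S \<subseteq> {1..m + 1}" "card S \<le> k + 1" by (auto simp: simplex_skeleton_def)
    then have fin: "finite S" using finite_subset by blast
    moreover have "card T \<le> k + 1" if "T \<subseteq> S" for T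
      using card_mono[OF fin that] S(2) by simp
    ultimately show ?thesis using S(1) unfolding simplex_skeleton_def by blast
  qed
  moreover have "{} \<in> simplex_skeleton m k" by (simp add: simplex_skeleton_def)
  ultimately show ?thesis unfolding simplicial_complex_def by blast
qed

lemma vertices_simplex_skeleton: "vertices (simplex_skeleton m k) = {1..m + 1}"
proof
  show "vertices (simplex_skeleton m k) \<subseteq> {1..m + 1}"
    by (auto simp: vertices_def simplex_skeleton_def)
  show "{1..m + 1} \<subseteq> vertices (simplex_skeleton m k)"
  proof
    fix x assume "x \<in> {1..m + 1}"
    then have "{x} \<in> simplex_skeleton m k" by (auto simp: simplex_skeleton_def)
    then show "x \<in> vertices (simplex_skeleton m k)" by (auto simp: vertices_def)
  qed
qed

lemma field_residue_ring:
  assumes "prime p"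
  shows "field (residue_ring (int p))"
proof -
  have "residues_prime p" using assms by unfold_locales
  then show ?thesis by (rule residues_prime.is_field)
qed

lemma vectorspace_Fp_space:
  assumes "prime p"
  shows "vectorspace (residue_ring (int p)) (Fp_space p n)"
proof -
  note F = field_residue_ring[OF assms]
  then have "cring (residue_ring (int p))" by (simp add: field_def domain_def)
  then have "module (residue_ring (int p)) (Fp_space p n)"
    unfolding Fp_space_def by (rule cring.func_space_is_module)
  then show ?thesis using F by (rule vectorspace.intro)
qed

lemma carrier_Fp_space:
  assumes "prime p"
  shows "carrier (Fp_space p n) = ({..<n} \<rightarrow>\<^sub>E {0..int p - 1})"
proof -
  have R: "ring (residue_ring (int p))"
    by (meson field_residue_ring[OF assms] cring.axioms(1) domain_def field_def)
  show ?thesis unfolding Fp_space_def ring.func_space_def[OF R] by (simp add: residue_ring_def)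
qed

lemma finite_carrier_Fp_space:
  assumes "prime p"
  shows "finite (carrier (Fp_space p n))"
  unfolding carrier_Fp_space[OF assms] by (intro finite_PiE) auto

lemma simplicial_complex_universal_complex:
  assumes "prime p"
  shows "simplicial_complex (universal_complex p n)"
proof -
  interpret V: vectorspace "residue_ring (int p)" "Fp_space p n"
    using assms by (rule vectorspace_Fp_space)
  show ?thesis
    unfolding simplicial_complex_def
  proof (intro conjI ballI allI impI)
    show "{} \<in> universal_complex p n" by (simp add: universal_complex_def V.lin_dep_def)
  next
    fix S assume "S \<in> universal_complex p n"
    then have S: "S \<subseteq> carrier (Fp_space p n)" "V.lin_indpt S"
      by (simp_all add: universal_complex_def)
    show "finite S" using finite_subset[OF S(1) finite_carrier_Fp_space[OF assms]] .
    show "T \<in> universal_complex p n" if "T \<subseteq> S" for T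
      using S(1) that V.subset_li_is_li[OF S(2) that] by (simp add: universal_complex_def)
  qed
qed

lemma vertices_universal_complex:
  assumes "prime p"
  shows "vertices (universal_complex p n) = carrier (Fp_space p n) - {\<zero>\<^bsub>Fp_space p n\<^esub>}"
proof -
  interpret V: vectorspace "residue_ring (int p)" "Fp_space p n"
    using assms by (rule vectorspace_Fp_space)
  have nz: "carrier (residue_ring (int p)) \<noteq> {\<zero>\<^bsub>residue_ring (int p)\<^esub>}"
    using V.R.carrier_one_not_zero by simp
  have "V.lin_indpt {v}" if v: "v \<in> carrier (Fp_space p n)" "v \<noteq> \<zero>\<^bsub>Fp_space p n\<^esub>" for v
  proof -
    have "v \<in> V.span {} \<longleftrightarrow> V.lin_dep ({} \<union> {v})"
      using v by (intro V.lin_dep_iff_in_span) (auto simp: V.lin_dep_def)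
    then show ?thesis using v by (auto simp: V.span_def V.lincomb_def)
  qed
  moreover have "\<zero>\<^bsub>Fp_space p n\<^esub> \<notin> S"
    if "S \<subseteq> carrier (Fp_space p n)" "V.lin_indpt S" for S
    using V.zero_nin_lin_indpt that nz by blast
  ultimately show ?thesis
    unfolding vertices_def universal_complex_def by blast
qed

end

theory Submission
  imports Defs
begin

text \<open>A nondegenerate simplicial map from the \<open>k\<close>-skeleton of the \<open>m\<close>-simplex to the universal
  complex of the coordinate space of dimension \<open>r\<close> is the same thing as a family of \<open>m + 1\<close>
  vectors of that space any \<open>k + 1\<close> of which are linearly independent, i.e. the columns of a
  parity check matrix of a linear code of length \<open>m + 1\<close> and minimum distance at least \<open>k + 2\<close>.
  The bound is therefore the Varshamov bound of coding theory, and it is proved by the same greedy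
  choice. Suppose that at most \<open>m\<close> vectors have been chosen. A new vector keeps all subfamilies
  of at most \<open>k + 1\<close> members independent as soon as it avoids the span of every subfamily of at
  most \<open>k\<close> members. These spans together contain at most
  \<open>(m choose 0) + (p - 1) * (m choose 1) + \<dots> + (p - 1) ^ k * (m choose k)\<close> vectors
  (\<open>card_spans_of_few_le\<close>), so the choice can go on until there are \<open>m + 1\<close> vectors whenever this
  number is smaller than \<open>p ^ r\<close> (\<open>exists_family_with_independent_subfamilies\<close>). That is true of the
  \<open>r\<close> given by the rounded logarithm, and the least possible \<open>r\<close> is at most this one.\<close>

section \<open>Counting the vectors spanned by few members of a family\<close>

context vectorspace
begin

definition nonvanishing_combinations :: "'c set \<Rightarrow> 'c set" where
  "nonvanishing_combinations B = {lincomb a B |a. a \<in> B \<rightarrow> carrier K - {\<zero>\<^bsub>K\<^esub>}}"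

lemma span_subset_nonvanishing_combinations:
  assumes "S \<subseteq> carrier V"
  shows "span S \<subseteq> (\<Union>B\<in>{B. finite B \<and> B \<subseteq> S}. nonvanishing_combinations B)"
proof
  fix v assume "v \<in> span S"
  then obtain a A where A: "finite A" "A \<subseteq> S" "a \<in> A \<rightarrow> carrier K" and v: "v = lincomb a A"
    by (auto simp: span_def)
  define B where "B = {x \<in> A. a x \<noteq> \<zero>\<^bsub>K\<^esub>}"
  have "lincomb a B = lincomb a A"
    unfolding lincomb_def
    by (rule M.add.finprod_mono_neutral_cong_left) (use A assms in \<open>auto simp: B_def\<close>)
  moreover have "a \<in> B \<rightarrow> carrier K - {\<zero>\<^bsub>K\<^esub>}"
    using A(3) by (auto simp: B_def)
  ultimately have "v \<in> nonvanishing_combinations B"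
    unfolding nonvanishing_combinations_def v by (metis (mono_tags, lifting) mem_Collect_eq)
  moreover have "finite B" "B \<subseteq> S" using A by (auto simp: B_def)
  ultimately show "v \<in> (\<Union>B\<in>{B. finite B \<and> B \<subseteq> S}. nonvanishing_combinations B)" by blast
qed

lemma nonvanishing_combinations_bound:
  assumes "finite (carrier K)" "finite B" "B \<subseteq> carrier V"
  shows "finite (nonvanishing_combinations B)"
    and "card (nonvanishing_combinations B) \<le> (card (carrier K) - 1) ^ card B"
proof -
  let ?F = "B \<rightarrow>\<^sub>E carrier K - {\<zero>\<^bsub>K\<^esub>}"
  have "nonvanishing_combinations B \<subseteq> (\<lambda>a. lincomb a B) ` ?F"
  proof
    fix v assume "v \<in> nonvanishing_combinations B"
    then obtain a where a: "a \<in> B \<rightarrow> carrier K - {\<zero>\<^bsub>K\<^esub>}" and v: "v = lincomb a B"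
      unfolding nonvanishing_combinations_def by blast
    have "v = lincomb (restrict a B) B"
      unfolding v using a assms(3) by (intro lincomb_cong) auto
    moreover have "restrict a B \<in> ?F" using a by auto
    ultimately show "v \<in> (\<lambda>a. lincomb a B) ` ?F" by blast
  qed
  moreover have "finite ?F" using assms by (intro finite_PiE) auto
  moreover have "card ?F = (card (carrier K) - 1) ^ card B"
    using assms by (simp add: card_funcsetE card_Diff_singleton)
  ultimately show "finite (nonvanishing_combinations B)"
    and "card (nonvanishing_combinations B) \<le> (card (carrier K) - 1) ^ card B"
    using surj_card_le by (blast intro: finite_subset, metis)
qed

text \<open>Discarding the zero coefficients makes every vector counted here a combination with nonzero
  coefficients of at most \<open>k\<close> members of the family. There are \<open>card I choose i\<close> choices of \<open>i\<close>
  members, and at most \<open>(q - 1) ^ i\<close> choices of their coefficients, where \<open>q\<close> is the order of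
  the field.\<close>

lemma card_spans_of_few_le:
  assumes K: "finite (carrier K)" and I: "finite I" and f: "f ` I \<subseteq> carrier V"
  shows "card (\<Union>T\<in>{T. T \<subseteq> I \<and> card T \<le> k}. span (f ` T))
    \<le> (\<Sum>i\<le>k. (card I choose i) * (card (carrier K) - 1) ^ i)"
proof -
  let ?q = "card (carrier K)"
  let ?subs = "\<lambda>i. {T. T \<subseteq> I \<and> card T = i}"
  let ?N = "\<lambda>i. \<Union>T\<in>?subs i. nonvanishing_combinations (f ` T)"
  have q: "1 \<le> ?q - 1"
  proof -
    have "card {\<zero>\<^bsub>K\<^esub>, \<one>\<^bsub>K\<^esub>} \<le> ?q" using K by (intro card_mono) auto
    then show ?thesis by simp
  qed
  have fin_subs: "finite (?subs i)" for i
    using I by simp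
  have fin_combs: "finite (nonvanishing_combinations (f ` T))" if "T \<subseteq> I" for T
    using K f I that by (intro nonvanishing_combinations_bound) (auto intro: finite_subset)
  have "(\<Union>T\<in>{T. T \<subseteq> I \<and> card T \<le> k}. span (f ` T)) \<subseteq> (\<Union>i\<le>k. ?N i)"
  proof
    fix v assume "v \<in> (\<Union>T\<in>{T. T \<subseteq> I \<and> card T \<le> k}. span (f ` T))"
    then obtain T where T: "T \<subseteq> I" "card T \<le> k" and "v \<in> span (f ` T)" by blast
    moreover have "f ` T \<subseteq> carrier V" using T f by blast
    ultimately obtain B where B: "B \<subseteq> f ` T" "v \<in> nonvanishing_combinations B"
      using span_subset_nonvanishing_combinations[of "f ` T"] by auto
    \<comment> \<open>The family may repeat vectors, so \<open>B\<close> has to be pulled back to a set of indices.\<close>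
    then obtain T' where T': "T' \<subseteq> T" "B = f ` T'" by (meson subset_imageE)
    have "card T' \<le> k"
      using T T' I by (meson card_mono finite_subset le_trans)
    then show "v \<in> (\<Union>i\<le>k. ?N i)" using T T' B by blast
  qed
  then have "card (\<Union>T\<in>{T. T \<subseteq> I \<and> card T \<le> k}. span (f ` T)) \<le> card (\<Union>i\<le>k. ?N i)"
    using fin_subs fin_combs by (intro card_mono) auto
  also have "\<dots> \<le> (\<Sum>i\<le>k. card (?N i))" by (rule card_UN_le) simp
  also have "\<dots> \<le> (\<Sum>i\<le>k. (card I choose i) * (?q - 1) ^ i)"
  proof (rule sum_mono)
    fix i
    have "card (?N i) \<le> (\<Sum>T\<in>?subs i. card (nonvanishing_combinations (f ` T)))"
      using fin_subs by (rule card_UN_le)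
    also have "\<dots> \<le> (\<Sum>T\<in>?subs i. (?q - 1) ^ i)"
    proof (rule sum_mono)
      fix T assume T: "T \<in> ?subs i"
      then have "finite T" using I by (auto intro: finite_subset)
      then have "card (nonvanishing_combinations (f ` T)) \<le> (?q - 1) ^ card (f ` T)"
        using K f T by (intro nonvanishing_combinations_bound) auto
      also have "\<dots> \<le> (?q - 1) ^ i"
        using q T card_image_le[OF \<open>finite T\<close>, of f] by (intro power_increasing) auto
      finally show "card (nonvanishing_combinations (f ` T)) \<le> (?q - 1) ^ i" .
    qed
    also have "\<dots> = (card I choose i) * (?q - 1) ^ i"
      using I by (simp add: n_subsets)
    finally show "card (?N i) \<le> (card I choose i) * (?q - 1) ^ i" .
  qed
  finally show ?thesis .
qed

section \<open>The greedy construction\<close>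

text \<open>The new vector is chosen outside all spans of at most \<open>k\<close> old ones; a subfamily of at most
  \<open>k + 1\<close> members that contains it has at most \<open>k\<close> old members, so it stays independent. When the
  last vector is chosen there are \<open>m\<close> old ones, which is why \<open>m\<close> and not \<open>m + 1\<close> is the upper
  entry of the binomial coefficients. The object constructed is a family and not a set of vectors:
  for \<open>k = 0\<close> repetitions are unavoidable if the space has at most \<open>m + 1\<close> elements.\<close>

lemma exists_family_with_independent_subfamilies:
  assumes K: "finite (carrier K)" and I: "finite I" "card I \<le> m + 1"
    and room: "(\<Sum>i\<le>k. (m choose i) * (card (carrier K) - 1) ^ i) < card (carrier V)"
  shows "\<exists>f. f ` I \<subseteq> carrier V \<and>
    (\<forall>S\<subseteq>I. card S \<le> k + 1 \<longrightarrow> inj_on f S \<and> lin_indpt (f ` S))"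
  using I
proof (induction I rule: finite_induct)
  case empty
  have "lin_indpt {}" by (simp add: lin_dep_def)
  then show ?case by simp
next
  case (insert x I)
  have "card I \<le> m" using insert.hyps insert.prems by simp
  then obtain f where f: "f ` I \<subseteq> carrier V"
    and indep: "\<And>S. S \<subseteq> I \<Longrightarrow> card S \<le> k + 1 \<Longrightarrow> inj_on f S \<and> lin_indpt (f ` S)"
    using insert.IH by (metis trans_le_add1)
  let ?U = "\<Union>T\<in>{T. T \<subseteq> I \<and> card T \<le> k}. span (f ` T)"
  have "(\<Sum>i\<le>k. (card I choose i) * (card (carrier K) - 1) ^ i)
      \<le> (\<Sum>i\<le>k. (m choose i) * (card (carrier K) - 1) ^ i)"
    using \<open>card I \<le> m\<close> by (intro sum_mono mult_right_mono binomial_right_mono) auto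
  then have "card ?U < card (carrier V)"
    using card_spans_of_few_le[OF K insert.hyps(1) f, of k] room by linarith
  moreover have "?U \<subseteq> carrier V"
    using f by (intro UN_least span_is_subset2) auto
  ultimately have "?U \<subset> carrier V"
    by (metis less_irrefl psubsetI)
  then obtain v where v: "v \<in> carrier V" "v \<notin> ?U"
    by (meson psubset_imp_ex_mem DiffE)
  define g where "g = f(x := v)"
  have gx: "g x = v" by (simp add: g_def)
  have old: "g ` S = f ` S" "inj_on g S \<longleftrightarrow> inj_on f S" if "S \<subseteq> I" for S
  proof -
    have "g y = f y" if "y \<in> S" for y
      using that \<open>S \<subseteq> I\<close> insert.hyps(2) by (auto simp: g_def)
    then show "g ` S = f ` S" "inj_on g S \<longleftrightarrow> inj_on f S"
      by (simp_all only: cong: image_cong inj_on_cong)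
  qed
  have "inj_on g S \<and> lin_indpt (g ` S)"
    if S: "S \<subseteq> insert x I" "card S \<le> k + 1" for S
  proof (cases "x \<in> S")
    case False
    then have "S \<subseteq> I" using S by blast
    then show ?thesis using old indep S(2) by metis
  next
    case True
    define T where "T = S - {x}"
    have "finite S" using S(1) insert.hyps(1) by (auto intro: finite_subset)
    then have "card T \<le> k" using S(2) True by (simp add: T_def)
    moreover have T: "T \<subseteq> I" "S = insert x T" "x \<notin> T" using S(1) True by (auto simp: T_def)
    ultimately have fT: "inj_on f T" "lin_indpt (f ` T)" "v \<notin> span (f ` T)"
      using indep[of T] v(2) by auto
    moreover have sub: "f ` T \<subseteq> carrier V" using f T by blast
    ultimately have "v \<notin> f ` T" using in_own_span[OF sub] by blast
    then have "lin_indpt (insert v (f ` T))"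
      using lin_dep_iff_in_span[OF sub fT(2) v(1)] fT(3) by simp
    moreover have "g ` S = insert v (f ` T)"
      using old(1)[OF T(1)] gx T(2) by simp
    moreover have "inj_on g S"
      using old[OF T(1)] gx fT(1) \<open>v \<notin> f ` T\<close> T(2,3) by simp
    ultimately show ?thesis by simp
  qed
  moreover have "g ` insert x I \<subseteq> carrier V"
    using old(1)[of I] gx v(1) f by simp
  ultimately show ?case by blast
qed

end

section \<open>The Buchstaber invariant of a skeleton\<close>

lemma card_carrier_Fp_space:
  assumes "prime p"
  shows "card (carrier (Fp_space p n)) = p ^ n"
  by (simp add: carrier_Fp_space[OF assms] card_funcsetE)

lemma nondegenerate_map_from_skeleton:
  assumes p: "prime p" and room: "(\<Sum>i\<le>k. (m choose i) * (p - 1) ^ i) < p ^ r"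
  shows "\<exists>f. nondegenerate_simplicial_map (simplex_skeleton m k) (universal_complex p r) f"
proof -
  interpret V: vectorspace "residue_ring (int p)" "Fp_space p r"
    using p by (rule vectorspace_Fp_space)
  have K: "finite (carrier (residue_ring (int p)))" "card (carrier (residue_ring (int p))) = p"
    by (simp_all add: residue_ring_def)
  obtain f where f: "f ` {1..m + 1} \<subseteq> carrier (Fp_space p r)"
    and indep: "\<forall>S\<subseteq>{1..m + 1}. card S \<le> k + 1 \<longrightarrow> inj_on f S \<and> V.lin_indpt (f ` S)"
    using V.exists_family_with_independent_subfamilies
        [OF K(1), of "{1..m + 1}" m k] room
    by (auto simp: K(2) card_carrier_Fp_space[OF p])
  have simplices: "inj_on f S" "f ` S \<in> universal_complex p r" if "S \<in> simplex_skeleton m k" for S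
    using that f indep by (auto simp: simplex_skeleton_def universal_complex_def)
  moreover have "f ` vertices (simplex_skeleton m k) \<subseteq> vertices (universal_complex p r)"
    using simplices(2) unfolding vertices_def by blast
  ultimately show ?thesis
    unfolding nondegenerate_simplicial_map_def simplicial_map_def by blast
qed

theorem corollary3p4:
  fixes p k m :: nat
  assumes "prime p" and "k \<le> m"
  shows "buchstaber_mod p (simplex_skeleton m k) \<ge>
    int m + 1 - \<lceil>log (real p) (1 + (\<Sum>i=0..k. (real p - 1) ^ i * real (m choose i)))\<rceil>"
proof -
  define N where "N = (\<Sum>i\<le>k. (m choose i) * (p - 1) ^ i)"
  \<comment> \<open>The extra \<open>1\<close> inside the logarithm is what makes \<open>N < p ^ r\<close> strict below.\<close>
  define r where "r = nat \<lceil>log (real p) (1 + real N)\<rceil>"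
  have p: "1 < p" using assms(1) by (rule prime_gt_1_nat)
  have N: "(\<Sum>i=0..k. (real p - 1) ^ i * real (m choose i)) = real N"
    using p by (simp add: N_def atMost_atLeast0 of_nat_diff mult.commute)
  have "0 \<le> log (real p) (1 + real N)" using p by simp
  then have r: "int r = \<lceil>log (real p) (1 + real N)\<rceil>"
    by (simp add: r_def)
  then have "log (real p) (1 + real N) \<le> real r" by linarith
  then have "1 + real N \<le> real (p ^ r)"
    using p by (simp add: log_le_iff powr_realpow)
  then have "N < p ^ r" by linarith
  then have "\<exists>f. nondegenerate_simplicial_map (simplex_skeleton m k) (universal_complex p r) f"
    using nondegenerate_map_from_skeleton[OF assms(1)] by (simp add: N_def)
  then have "(LEAST r. \<exists>f. nondegenerate_simplicial_map (simplex_skeleton m k)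
      (universal_complex p r) f) \<le> r"
    by (rule Least_le)
  then show ?thesis
    by (simp add: buchstaber_mod_def vertices_simplex_skeleton N flip: r)
qed

end
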